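(* Let $n,k\ge 2$ with $k$ even, let $G$ be a $k$-uniform hypergraph with vertex set $[n]$, and let $E\subseteq E(G)$. Let $\mathbf{x}$ and $\mathbf{y}$ be least eigenvectors of $G$ and $G-E$, respectively. Then $$\lambda(G)-k\sum_{e\in E}\mathbf{y}^e\ \le\ \lambda(G-E)\ \le\ \lambda(G)-k\sum_{e\in E}\mathbf{x}^e.$$
   Context: $[n]=\{1,\dots,n\}$. A $k$-uniform hypergraph $G$ has vertex set $V(G)$ and edge set $E(G)$ consisting of $k$-element subsets of $V(G)$. Its adjacency tensor $\mathcal{A}(G)=(a_{i_1\dots i_k})$ has order $k$ and dimension $|V(G)|$, with $a_{i_1\dots i_k}=\frac{1}{(k-1)!}$ if $\{i_1,\dots,i_k\}\in E(G)$ and $0$ otherwise. For a vector $\mathbf{x}$ indexed by $V(G)$ and $U\subseteq V(G)$, $\mathbf{x}^U=\prod_{w\in U}x_w$. A real number $\lambda$ is an H-eigenvalue of $\mathcal{A}(G)$ with H-eigenvector $\mathbf{x}$ (a nonzero real vector) if $\lambda x_u^{k-1}=\sum_{e\in E(G),\,u\in e}\mathbf{x}^{e\setminus\{u\}}$ for all $u\in V(G)$. $\lambda(G)$ denotes the least H-eigenvalue of $\mathcal{A}(G)$. A least eigenvector of $G$ is a real vector $\mathbf{x}$ with $\sum_i|x_i|^k=1$ that is an eigenvector of $\mathcal{A}(G)$ associated with $\lambda(G)$. $G-E$ is the hypergraph with vertex set $V(G)$ and edge set $E(G)\setminus E$. *)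

theory Defs
  imports "HOL-Analysis.Analysis" "HOL-Combinatorics.Multiset_Permutations"
begin

record 'a hypergraph =
  verts :: "'a set"
  edges :: "'a set set"

definition uniform_hypergraph :: "nat \<Rightarrow> 'a hypergraph \<Rightarrow> bool" where
  "uniform_hypergraph k G \<longleftrightarrow>
     finite (verts G) \<and> (\<forall>e\<in>edges G. e \<subseteq> verts G \<and> card e = k)"

definition delete_edges :: "'a hypergraph \<Rightarrow> 'a set set \<Rightarrow> 'a hypergraph" where
  "delete_edges G E = G\<lparr>edges := edges G - E\<rparr>"

text \<open>
  A tensor of order k indexed by a set V is a function on lists of length k over V.
\<close>

definition adjacency_tensor :: "nat \<Rightarrow> 'a hypergraph \<Rightarrow> 'a list \<Rightarrow> real" where
  "adjacency_tensor k G is =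
     (if length is = k \<and> set is \<in> edges G then 1 / fact (k - 1) else 0)"

text \<open>
  A vector indexed by the vertices is a total function whose values outside the vertex set
  are irrelevant; being nonzero therefore refers to the vertices only.
  The eigenvalue equation is the edge form of the tensor equation for the adjacency tensor;
  the lemma \<open>H_eigenpair_iff_adjacency_tensor\<close> below shows that the two agree.
\<close>

definition H_eigenpair :: "nat \<Rightarrow> 'a hypergraph \<Rightarrow> real \<Rightarrow> ('a \<Rightarrow> real) \<Rightarrow> bool" where
  "H_eigenpair k G \<mu> x \<longleftrightarrow>
     (\<exists>u\<in>verts G. x u \<noteq> 0) \<and>
     (\<forall>u\<in>verts G. \<mu> * x u ^ (k - 1) = (\<Sum>e | e \<in> edges G \<and> u \<in> e. \<Prod>w\<in>e - {u}. x w))"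

definition H_eigenvalue :: "nat \<Rightarrow> 'a hypergraph \<Rightarrow> real \<Rightarrow> bool" where
  "H_eigenvalue k G \<mu> \<longleftrightarrow> (\<exists>x. H_eigenpair k G \<mu> x)"

definition least_H_eigenvalue :: "nat \<Rightarrow> 'a hypergraph \<Rightarrow> real" where
  "least_H_eigenvalue k G = (LEAST \<mu>. H_eigenvalue k G \<mu>)"

definition least_eigenvector :: "nat \<Rightarrow> 'a hypergraph \<Rightarrow> ('a \<Rightarrow> real) \<Rightarrow> bool" where
  "least_eigenvector k G x \<longleftrightarrow>
     (\<Sum>i\<in>verts G. \<bar>x i\<bar> ^ k) = 1 \<and> H_eigenpair k G (least_H_eigenvalue k G) x"

lemma adjacency_tensor_apply:
  fixes x :: "'a \<Rightarrow> real"
  assumes G: "uniform_hypergraph k G" and k: "k > 0"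
  shows "(\<Sum>is | set is \<subseteq> verts G \<and> length is = k - 1.
            adjacency_tensor k G (u # is) * prod_list (map x is)) =
         (\<Sum>e | e \<in> edges G \<and> u \<in> e. \<Prod>w\<in>e - {u}. x w)"
proof -
  let ?L = "{is. set is \<subseteq> verts G \<and> length is = k - 1}"
  let ?D = "{e. e \<in> edges G \<and> u \<in> e}"
  let ?f = "\<lambda>is. adjacency_tensor k G (u # is) * prod_list (map x is)"
  let ?P = "\<lambda>e. permutations_of_set (e - {u})"
  have finV: "finite (verts G)" and sub: "\<And>e. e \<in> edges G \<Longrightarrow> e \<subseteq> verts G"
    and crd: "\<And>e. e \<in> edges G \<Longrightarrow> card e = k"
    using G by (auto simp: uniform_hypergraph_def)
  have fine: "finite e" if "e \<in> edges G" for e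
    using finV sub that finite_subset by blast
  have "edges G \<subseteq> Pow (verts G)" using sub by blast
  then have finE: "finite (edges G)" using finV finite_subset by blast
  have len: "length is = k - 1" if "e \<in> ?D" "is \<in> ?P e" for e "is"
  proof -
    have s: "set is = e - {u}" "distinct is"
      using that(2) by (auto simp: permutations_of_set_def)
    have "length is = card (e - {u})" using distinct_card[OF s(2)] s(1) by simp
    also have "\<dots> = k - 1" using that(1) crd by simp
    finally show ?thesis .
  qed
  have PL: "(\<Union>e\<in>?D. ?P e) \<subseteq> ?L"
  proof
    fix "is" assume "is \<in> (\<Union>e\<in>?D. ?P e)"
    then obtain e where e: "e \<in> ?D" "is \<in> ?P e" by blast
    have "set is = e - {u}" using e(2) by (simp add: permutations_of_set_def)
    moreover have "e \<subseteq> verts G" using e(1) sub by blast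
    ultimately show "is \<in> ?L" using len[OF e] by auto
  qed
  have zero: "?f is = 0" if "is \<in> ?L - (\<Union>e\<in>?D. ?P e)" for "is"
  proof (cases "insert u (set is) \<in> edges G")
    case True
    have L: "length is = k - 1" using that by simp
    have c: "card (insert u (set is)) = k" using crd True by blast
    have le: "card (set is) \<le> k - 1" using L card_length[of "is"] by simp
    have nu: "u \<notin> set is"
    proof
      assume "u \<in> set is"
      then have "card (set is) = k" using c by (simp add: insert_absorb)
      then show False using le k by simp
    qed
    then have "card (set is) = length is" using c L k by simp
    then have "distinct is" by (rule card_distinct)
    then have "is \<in> ?P (insert u (set is))"
      using nu by (auto simp: permutations_of_set_def)
    then show ?thesis using that True by blast
  qed (simp add: adjacency_tensor_def)
  have val: "?f is = (\<Prod>w\<in>e - {u}. x w) / fact (k - 1)"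
    if "e \<in> ?D" "is \<in> ?P e" for e "is"
  proof -
    have s: "set is = e - {u}" "distinct is"
      using that(2) by (auto simp: permutations_of_set_def)
    have "insert u (set is) = e" using s that by auto
    then have "adjacency_tensor k G (u # is) = 1 / fact (k - 1)"
      using len[OF that] that k by (simp add: adjacency_tensor_def)
    moreover have "prod_list (map x is) = (\<Prod>w\<in>e - {u}. x w)"
      using s by (metis prod.distinct_set_conv_list)
    ultimately show ?thesis by simp
  qed
  have "sum ?f ?L = sum ?f (\<Union>e\<in>?D. ?P e)"
    using PL zero finV by (intro sum.mono_neutral_right) (auto simp: finite_lists_length_eq)
  also have "\<dots> = (\<Sum>e\<in>?D. sum ?f (?P e))"
  proof (rule sum.UNION_disjoint)
    show "\<forall>e\<in>?D. \<forall>e'\<in>?D. e \<noteq> e' \<longrightarrow> ?P e \<inter> ?P e' = {}"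
      by (auto simp: permutations_of_set_def)
  qed (use finE in auto)
  also have "\<dots> = (\<Sum>e\<in>?D. \<Prod>w\<in>e - {u}. x w)"
  proof (rule sum.cong)
    fix e assume e: "e \<in> ?D"
    have "card (?P e) = fact (k - 1)"
      using e fine crd by (simp add: card_permutations_of_set)
    then show "sum ?f (?P e) = (\<Prod>w\<in>e - {u}. x w)"
      using val[OF e] by simp
  qed simp
  finally show ?thesis .
qed

lemma H_eigenpair_iff_adjacency_tensor:
  assumes "uniform_hypergraph k G" "k > 0"
  shows "H_eigenpair k G \<mu> x \<longleftrightarrow>
     (\<exists>u\<in>verts G. x u \<noteq> 0) \<and>
     (\<forall>u\<in>verts G.
        (\<Sum>is | set is \<subseteq> verts G \<and> length is = k - 1.
           adjacency_tensor k G (u # is) * prod_list (map x is)) = \<mu> * x u ^ (k - 1))"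
  unfolding H_eigenpair_def adjacency_tensor_apply[OF assms] by auto

end

theory Submission
  imports Defs
begin

text \<open>
  The least H-eigenvalue is a minimum, and the theorem only compares the values of two minimised
  forms at each other's minimisers.  Write \<open>P\<^sub>G z\<close> for the sum of the edge products
  \<open>\<Prod>w\<in>e. z w\<close> of \<open>G\<close>.  Multiplying the equation of an eigenpair \<open>(\<mu>, z)\<close> at \<open>u\<close> by \<open>z u\<close> and
  summing over \<open>u\<close> counts every edge \<open>k\<close> times, so \<open>\<mu> * (\<Sum>u. z u ^ k) = k * P\<^sub>G z\<close>
  (\<open>eigenpair_edge_sum\<close>).

  For even \<open>k\<close> the set \<open>\<Sum>u. z u ^ k = 1\<close> is compact and \<open>P\<^sub>G\<close> attains a minimum on it
  at some \<open>x\<close>.  Since both sides are homogeneous of degree \<open>k\<close>,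
  \<open>P\<^sub>G x * (\<Sum>u. z u ^ k) \<le> P\<^sub>G z\<close> for every \<open>z\<close> (\<open>ex_edge_sum_minimiser\<close>), and equality at
  \<open>z = x\<close> makes \<open>x\<close> a critical point of the difference.  Being critical in each single
  coordinate is the eigenvalue equation (\<open>eigenpair_of_minimiser\<close>), so \<open>k * P\<^sub>G x\<close> is an
  eigenvalue; by the identity above no eigenvalue is smaller.  Hence
  \<open>\<lambda>(G) * (\<Sum>u. z u ^ k) \<le> k * P\<^sub>G z\<close> for every \<open>z\<close> (\<open>least_H_eigenvalue_le_edge_sum\<close>),
  with equality at every least eigenvector.

  Deleting \<open>E\<close> subtracts the sum of the products over \<open>E\<close> from \<open>P\<^sub>G z\<close>.  The upper bound
  is the inequality for \<open>G - E\<close> at the least eigenvector of \<open>G\<close>, and the lower bound is the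
  inequality for \<open>G\<close> at the least eigenvector of \<open>G - E\<close>.
\<close>

definition edge_sum :: "'a hypergraph \<Rightarrow> ('a \<Rightarrow> real) \<Rightarrow> real" where
  "edge_sum G x = (\<Sum>e\<in>edges G. \<Prod>w\<in>e. x w)"

lemma uniform_hypergraph_finite:
  assumes "uniform_hypergraph k G"
  shows "finite (verts G)" "finite (edges G)" "e \<in> edges G \<Longrightarrow> finite e"
proof -
  show V: "finite (verts G)" using assms by (simp add: uniform_hypergraph_def)
  have "edges G \<subseteq> Pow (verts G)" using assms by (auto simp: uniform_hypergraph_def)
  then show "finite (edges G)" using V by (simp add: finite_subset)
  show "finite e" if "e \<in> edges G"
    using assms that V by (auto simp: uniform_hypergraph_def intro: finite_subset)
qed

lemma edge_sum_scale:
  assumes "uniform_hypergraph k G"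
  shows "edge_sum G (\<lambda>i. c * x i) = c ^ k * edge_sum G x"
proof -
  have "(\<Prod>w\<in>e. c * x w) = c ^ k * (\<Prod>w\<in>e. x w)" if "e \<in> edges G" for e
    using assms that by (auto simp: prod.distrib uniform_hypergraph_def)
  then show ?thesis by (simp add: edge_sum_def sum_distrib_left)
qed

text \<open>
  Both sides are the sum of the edge products over all incident pairs of a vertex and an edge.
\<close>

lemma eigenpair_edge_sum:
  assumes G: "uniform_hypergraph k G" and k: "k > 0" and x: "H_eigenpair k G \<mu> x"
  shows "\<mu> * (\<Sum>u\<in>verts G. x u ^ k) = real k * edge_sum G x"
proof -
  note fin = uniform_hypergraph_finite[OF G]
  let ?p = "\<lambda>e. \<Prod>w\<in>e. x w"
  have "\<mu> * x u ^ k = (\<Sum>e\<in>edges G. if u \<in> e then ?p e else 0)" if u: "u \<in> verts G" for u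
  proof -
    have "\<mu> * x u ^ k = x u * (\<mu> * x u ^ (k - 1))"
      using k by (simp add: power_eq_if)
    also have "\<dots> = (\<Sum>e | e \<in> edges G \<and> u \<in> e. x u * (\<Prod>w\<in>e - {u}. x w))"
      using x u by (simp add: H_eigenpair_def sum_distrib_left)
    also have "\<dots> = (\<Sum>e | e \<in> edges G \<and> u \<in> e. ?p e)"
      using fin by (intro sum.cong) (auto simp: prod.remove)
    also have "\<dots> = (\<Sum>e\<in>edges G. if u \<in> e then ?p e else 0)"
      using fin by (simp add: sum.inter_filter)
    finally show ?thesis .
  qed
  then have "\<mu> * (\<Sum>u\<in>verts G. x u ^ k)
      = (\<Sum>u\<in>verts G. \<Sum>e\<in>edges G. if u \<in> e then ?p e else 0)"
    by (simp add: sum_distrib_left)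
  also have "\<dots> = (\<Sum>e\<in>edges G. \<Sum>u\<in>verts G. if u \<in> e then ?p e else 0)"
    by (rule sum.swap)
  also have "\<dots> = (\<Sum>e\<in>edges G. real k * ?p e)"
  proof (rule sum.cong)
    fix e assume e: "e \<in> edges G"
    then have "{u \<in> verts G. u \<in> e} = e" "card e = k"
      using G by (auto simp: uniform_hypergraph_def)
    then show "(\<Sum>u\<in>verts G. if u \<in> e then ?p e else 0) = real k * ?p e"
      using fin by (simp flip: sum.inter_filter)
  qed simp
  finally show ?thesis by (simp add: edge_sum_def sum_distrib_left)
qed

text \<open>
  Compactness is taken in the product topology on all functions: the values off \<open>V\<close> are pinned
  to \<open>0\<close>, and those on \<open>V\<close> lie in \<open>[-1, 1]\<close>, because no term \<open>x i ^ k\<close> of a sum of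
  nonnegative terms exceeds the total \<open>1\<close>.
\<close>

lemma compact_even_power_sphere:
  fixes V :: "'a set"
  assumes V: "finite V" and k: "even k" "k > 0"
  shows "compact {x :: 'a \<Rightarrow> real. (\<Sum>i\<in>V. x i ^ k) = 1 \<and> (\<forall>i. i \<notin> V \<longrightarrow> x i = 0)}"
    (is "compact ?S")
proof -
  let ?B = "\<lambda>i. if i \<in> V then {-1..1::real} else {0}"
  let ?K = "PiE UNIV ?B"
  have "compactin (product_topology (\<lambda>i. euclidean) UNIV) ?K"
    by (subst compactin_PiE) auto
  then have K: "compact ?K"
    by (simp add: euclidean_product_topology)
  have "continuous_on UNIV (\<lambda>x :: 'a \<Rightarrow> real. \<Sum>i\<in>V. x i ^ k)"
    by (intro continuous_intros continuous_on_product_coordinates)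
  then have C: "closed {x :: 'a \<Rightarrow> real. (\<Sum>i\<in>V. x i ^ k) = 1}"
    by (rule closed_Collect_eq[OF _ continuous_on_const])
  have "x i \<in> ?B i" if x: "x \<in> ?S" for x i
  proof (cases "i \<in> V")
    case True
    have "x i ^ k \<le> (\<Sum>i\<in>V. x i ^ k)"
      using V True k by (intro member_le_sum) (auto simp: zero_le_even_power)
    then have "\<bar>x i\<bar> ^ k \<le> 1 ^ k"
      using x k by (simp add: power_even_abs)
    then have "\<bar>x i\<bar> \<le> 1"
      using k power_mono_iff[of "\<bar>x i\<bar>" 1 k] by simp
    then show ?thesis using True by auto
  qed (use x in simp)
  then have "?S = ?K \<inter> {x. (\<Sum>i\<in>V. x i ^ k) = 1}"
    by (auto simp: PiE_iff split: if_splits)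
  then show ?thesis using compact_Int_closed[OF K C] by simp
qed

lemma ex_edge_sum_minimiser:
  fixes G :: "'a hypergraph"
  assumes G: "uniform_hypergraph k G" and ne: "verts G \<noteq> {}" and k: "even k" "k > 0"
  obtains x where "(\<Sum>i\<in>verts G. x i ^ k) = 1"
    and "\<And>z. edge_sum G x * (\<Sum>i\<in>verts G. z i ^ k) \<le> edge_sum G z"
proof -
  note fin = uniform_hypergraph_finite[OF G]
  define S where "S = {x :: 'a \<Rightarrow> real.
    (\<Sum>i\<in>verts G. x i ^ k) = 1 \<and> (\<forall>i. i \<notin> verts G \<longrightarrow> x i = 0)}"
  have "compact S"
    unfolding S_def using fin(1) k by (rule compact_even_power_sphere)
  moreover obtain v where v: "v \<in> verts G" using ne by blast
  have "(\<lambda>i. if i = v then 1 else 0) \<in> S"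
  proof -
    have "(\<Sum>i\<in>verts G. (if i = v then 1 else 0 :: real) ^ k)
        = (\<Sum>i\<in>verts G. if i = v then 1 else 0)"
      using k by (intro sum.cong) auto
    then show ?thesis using v fin by (auto simp: S_def)
  qed
  then have "S \<noteq> {}" by blast
  moreover have "continuous_on S (edge_sum G)"
    unfolding edge_sum_def
    by (intro continuous_intros continuous_on_subset[OF continuous_on_product_coordinates]) simp
  ultimately obtain x where x: "x \<in> S" "\<And>y. y \<in> S \<Longrightarrow> edge_sum G x \<le> edge_sum G y"
    using continuous_attains_inf[of S "edge_sum G"] by blast
  have "edge_sum G x * (\<Sum>i\<in>verts G. z i ^ k) \<le> edge_sum G z" for z
  proof -
    let ?s = "\<Sum>i\<in>verts G. z i ^ k"
    \<comment> \<open>Only the values on the vertices matter, so \<open>z\<close> is cut off before it is normalised.\<close>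
    define z' where "z' i = (if i \<in> verts G then z i else 0)" for i
    have "(\<Prod>w\<in>e. z' w) = (\<Prod>w\<in>e. z w)" if "e \<in> edges G" for e
      using G that by (intro prod.cong) (auto simp: z'_def uniform_hypergraph_def)
    then have z': "edge_sum G z' = edge_sum G z" "(\<Sum>i\<in>verts G. z' i ^ k) = ?s"
      by (auto simp: edge_sum_def z'_def)
    have nonneg: "?s \<ge> 0" using k by (intro sum_nonneg) (auto simp: zero_le_even_power)
    show ?thesis
    proof (cases "?s = 0")
      case True
      then have "\<forall>i\<in>verts G. z i ^ k = 0"
        using fin k by (subst (asm) sum_nonneg_eq_0_iff) (auto simp: zero_le_even_power)
      then have "z' = (\<lambda>i. 0 * z i)" by (auto simp: z'_def)
      then have "edge_sum G z' = 0"
        using edge_sum_scale[OF G, of 0 z] k by simp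
      then show ?thesis using z' True by simp
    next
      case False
      define c where "c = root k ?s"
      have c: "c > 0" "c ^ k = ?s"
        using nonneg False k by (auto simp: c_def real_root_pow_pos2)
      have "(\<lambda>i. inverse c * z' i) \<in> S"
        using c z' False by (auto simp: S_def power_mult_distrib power_inverse z'_def
          simp flip: sum_distrib_left)
      from x(2)[OF this] have "edge_sum G x \<le> inverse ?s * edge_sum G z"
        using edge_sum_scale[OF G, of "inverse c" z'] c z' by (simp add: power_inverse)
      then show ?thesis using nonneg False by (simp add: field_simps)
    qed
  qed
  moreover have "(\<Sum>i\<in>verts G. x i ^ k) = 1" using x(1) by (simp add: S_def)
  ultimately show thesis using that by blast
qed

text \<open>
  The edge sum is affine in each single coordinate \<open>u\<close>, with the right-hand side of the eigenvalue
  equation at \<open>u\<close> as its slope.  The difference of the two sides of the inequality is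
  nonnegative and vanishes at \<open>x\<close>, so its partial derivatives vanish there.
\<close>

lemma eigenpair_of_minimiser:
  assumes G: "uniform_hypergraph k G" and k: "k > 0"
    and one: "(\<Sum>i\<in>verts G. x i ^ k) = 1"
    and min: "\<And>z. edge_sum G x * (\<Sum>i\<in>verts G. z i ^ k) \<le> edge_sum G z"
  shows "H_eigenpair k G (real k * edge_sum G x) x"
  unfolding H_eigenpair_def
proof (intro conjI ballI)
  show "\<exists>u\<in>verts G. x u \<noteq> 0"
  proof (rule ccontr)
    assume "\<not> ?thesis"
    then have "(\<Sum>i\<in>verts G. x i ^ k) = 0" using k by simp
    then show False using one by simp
  qed
next
  fix u assume u: "u \<in> verts G"
  note fin = uniform_hypergraph_finite[OF G]
  let ?m = "edge_sum G x"
  let ?d = "\<Sum>e | e \<in> edges G \<and> u \<in> e. \<Prod>w\<in>e - {u}. x w"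
  define a where "a = (\<Sum>e | e \<in> edges G \<and> u \<notin> e. \<Prod>w\<in>e. x w)"
  define b where "b = (\<Sum>i\<in>verts G - {u}. x i ^ k)"
  define g where "g t = t * ?d + a - ?m * (t ^ k + b)" for t
  have edge: "edge_sum G (x(u := t)) = t * ?d + a" for t
  proof -
    let ?p = "\<lambda>e. \<Prod>w\<in>e. (x(u := t)) w"
    have "edge_sum G (x(u := t))
        = (\<Sum>e | e \<in> edges G \<and> u \<in> e. ?p e) + (\<Sum>e | e \<in> edges G \<and> u \<notin> e. ?p e)"
      unfolding edge_sum_def using fin
      by (subst sum.union_disjoint[symmetric]) (auto intro!: sum.cong)
    moreover have "?p e = t * (\<Prod>w\<in>e - {u}. x w)" if "e \<in> edges G" "u \<in> e" for e
      using fin that by (simp add: prod.remove[of e u])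
    moreover have "?p e = (\<Prod>w\<in>e. x w)" if "u \<notin> e" for e
      using that by (intro prod.cong) auto
    ultimately show ?thesis by (simp add: a_def sum_distrib_left)
  qed
  have pow: "(\<Sum>i\<in>verts G. (x(u := t)) i ^ k) = t ^ k + b" for t
    using fin u by (simp add: sum.remove[of "verts G" u] b_def)
  have "g (x u) = 0"
    using edge[of "x u"] pow[of "x u"] one by (simp add: g_def)
  moreover have "g t \<ge> 0" for t
    using min[of "x(u := t)"] edge[of t] pow[of t] by (simp add: g_def)
  ultimately have "\<forall>t. \<bar>x u - t\<bar> < 1 \<longrightarrow> g (x u) \<le> g t" by simp
  moreover have "(g has_real_derivative (?d - ?m * (real k * x u ^ (k - 1)))) (at (x u))"
    unfolding g_def by (auto intro!: derivative_eq_intros)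
  ultimately have "?d - ?m * (real k * x u ^ (k - 1)) = 0"
    by (intro DERIV_local_min[of g _ "x u" 1]) auto
  then show "real k * ?m * x u ^ (k - 1) = ?d" by (simp add: mult_ac)
qed

lemma least_H_eigenvalue_le_edge_sum:
  assumes G: "uniform_hypergraph k G" and ne: "verts G \<noteq> {}" and k: "even k" "k > 0"
  shows "least_H_eigenvalue k G * (\<Sum>i\<in>verts G. z i ^ k) \<le> real k * edge_sum G z"
proof -
  obtain x where x: "(\<Sum>i\<in>verts G. x i ^ k) = 1"
    and min: "\<And>z. edge_sum G x * (\<Sum>i\<in>verts G. z i ^ k) \<le> edge_sum G z"
    using ex_edge_sum_minimiser[OF assms] by blast
  let ?m = "edge_sum G x"
  have "least_H_eigenvalue k G = real k * ?m"
    unfolding least_H_eigenvalue_def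
  proof (rule Least_equality)
    show "H_eigenvalue k G (real k * ?m)"
      using eigenpair_of_minimiser[OF G k(2) x min] by (auto simp: H_eigenvalue_def)
  next
    fix \<mu> assume "H_eigenvalue k G \<mu>"
    then obtain y where y: "H_eigenpair k G \<mu> y" by (auto simp: H_eigenvalue_def)
    let ?s = "\<Sum>i\<in>verts G. y i ^ k"
    obtain u where "u \<in> verts G" "y u \<noteq> 0" using y by (auto simp: H_eigenpair_def)
    then have s: "?s > 0"
      using k uniform_hypergraph_finite(1)[OF G]
      by (intro sum_pos2[of _ u]) (auto simp: zero_le_even_power zero_less_power_eq)
    have "real k * ?m * ?s \<le> real k * edge_sum G y"
      using mult_left_mono[OF min[of y], of "real k"] by (simp add: mult.assoc)
    also have "\<dots> = \<mu> * ?s"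
      using eigenpair_edge_sum[OF G k(2) y] by simp
    finally show "real k * ?m \<le> \<mu>" using s by simp
  qed
  then show ?thesis
    using mult_left_mono[OF min[of z], of "real k"] by (simp add: mult.assoc)
qed

lemma least_eigenvector_edge_sum:
  assumes "uniform_hypergraph k G" and k: "even k" "k > 0" and x: "least_eigenvector k G x"
  shows "(\<Sum>i\<in>verts G. x i ^ k) = 1" "least_H_eigenvalue k G = real k * edge_sum G x"
proof -
  show one: "(\<Sum>i\<in>verts G. x i ^ k) = 1"
    using x k by (simp add: least_eigenvector_def power_even_abs)
  show "least_H_eigenvalue k G = real k * edge_sum G x"
    using eigenpair_edge_sum[OF assms(1) k(2), of "least_H_eigenvalue k G" x] x one
    by (simp add: least_eigenvector_def)
qed

lemma edge_sum_delete_edges: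
  assumes "uniform_hypergraph k G" and "E \<subseteq> edges G"
  shows "edge_sum (delete_edges G E) x = edge_sum G x - (\<Sum>e\<in>E. \<Prod>w\<in>e. x w)"
  using uniform_hypergraph_finite[OF assms(1)] assms(2)
  by (simp add: edge_sum_def delete_edges_def sum_diff)

theorem theorem5p2:
  fixes n k :: nat and G :: "nat hypergraph" and E :: "nat set set"
    and x y :: "nat \<Rightarrow> real"
  assumes "n \<ge> 2" and "k \<ge> 2" and "even k"
    and "uniform_hypergraph k G" and "verts G = {1..n}"
    and "E \<subseteq> edges G"
    and "least_eigenvector k G x"
    and "least_eigenvector k (delete_edges G E) y"
  shows "least_H_eigenvalue k G - real k * (\<Sum>e\<in>E. \<Prod>w\<in>e. y w)
           \<le> least_H_eigenvalue k (delete_edges G E)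
       \<and> least_H_eigenvalue k (delete_edges G E)
           \<le> least_H_eigenvalue k G - real k * (\<Sum>e\<in>E. \<Prod>w\<in>e. x w)"
proof -
  let ?H = "delete_edges G E"
  have k: "even k" "k > 0" using assms(2,3) by auto
  have H: "uniform_hypergraph k ?H" and V: "verts ?H = verts G"
    using assms(4) by (auto simp: uniform_hypergraph_def delete_edges_def)
  have ne: "verts G \<noteq> {}" "verts ?H \<noteq> {}" using assms(1,5) V by auto
  note x = least_eigenvector_edge_sum[OF assms(4) k assms(7)]
  note y = least_eigenvector_edge_sum[OF H k assms(8)]
  note del = edge_sum_delete_edges[OF assms(4,6)]
  have "least_H_eigenvalue k G \<le> real k * edge_sum G y"
    using least_H_eigenvalue_le_edge_sum[OF assms(4) ne(1) k, of y] y(1) V by simp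
  moreover have "least_H_eigenvalue k ?H \<le> real k * edge_sum ?H x"
    using least_H_eigenvalue_le_edge_sum[OF H ne(2) k, of x] x(1) V by simp
  ultimately show ?thesis
    using x(2) y(2) del[of x] del[of y] by (simp add: right_diff_distrib)
qed

end
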